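(* Let $m\ge2$ and let $\Omega_1,\dots,\Omega_m\subset\mathbb E$ be nonempty, closed and convex, with $S_0:=\operatorname{Fix}P_0\neq\emptyset$. Let $\bar\zeta\in\mathcal Z(u)$ for any $u\in S_0$ (in the convex case $\mathcal Z(u)=\{\bar\zeta\}$ for all $u\in S_0$), let $S_j:=S_0-\sum_{i=1}^{j-1}\bar\zeta_i$ for $j=1,\dots,m$, $S:=S_1\times\cdots\times S_m$, and $\Lambda:=W(\bar\zeta)$. Suppose that (b$'$) for each $\hat x\in S$ with $\hat x-\Pi\hat x=\bar\zeta$, the collection $\{\Omega_1,\dots,\Omega_m\}$ is subtransversal at $\hat x$ for $\bar\zeta$ relative to $\Lambda$ on a neighborhood $U\supset S$ (with constant $\kappa$); (c$'$) there is $\sigma>0$ such that $\operatorname{dist}(\bar\zeta,\Psi(x))\le\sigma\operatorname{dist}(0,\Phi_{\bar\zeta}(x))$ whenever $x\in\Lambda\cap U$ with $x_1\in\Omega_1$. Then the sequence $(x^k)_{k\in\mathbb N}$ generated by $x^{k+1}\in T_{\bar\zeta}x^k$ from any point $x^0\in W(\bar\zeta)$ with $x^0_1\in\Omega_1$ satisfies $$\operatorname{dist}(x^{k+1},\operatorname{Fix}T_{\bar\zeta}\cap S)\le c\,\operatorname{dist}(x^k,S)$$ for all $k$ large enough, where $$c:=\sqrt{1-\frac{1-\alpha}{\alpha\bar\kappa^2}}<1,\qquad \bar\kappa:=\kappa\sigma,\qquad\alpha:=\frac m{m+1},$$ and $\kappa$ is a constant of metric subregularity of $\Psi$ for $\bar\zeta$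 on $U$ relative to $\Lambda$. In other words, $\operatorname{dist}(x^k,\operatorname{Fix}T_{\bar\zeta}\cap S)\to0$, and hence $\operatorname{dist}(x_1^k,\operatorname{Fix}P_0\cap S_0)\to0$, at least R-linearly with rate $c<1$.
   Context: $\mathbb E$ is a finite-dimensional Euclidean space; $\mathbb E^m$ carries the product Euclidean norm. $P_\Omega$ is the Euclidean projector. $\operatorname{Fix}T=\{x: x\in Tx\}$. A neighborhood of a set is a set whose interior contains it. $\Pi(x_1,\dots,x_m)=(x_2,\dots,x_m,x_1)$. $\Omega=\Omega_1\times\cdots\times\Omega_m$. $P_0=P_{\Omega_1}P_{\Omega_2}\cdots P_{\Omega_m}P_{\Omega_1}$. $W_0=\{x\in\mathbb E^m: x_m\in P_{\Omega_m}x_1,\ x_j\in P_{\Omega_j}x_{j+1},\ j=1,\dots,m-1\}$. $\mathcal Z(u)=\{z-\Pi z: z\in W_0,\ z_1=u\}$. $W(\zeta)=\{x\in\mathbb E^m: x-\Pi x=\zeta\}$. $T_\zeta x=\{(x_1^+,x_1^+-\zeta_1,\dots,x_1^+-\sum_{i=1}^{m-1}\zeta_i): x_1^+\in P_0x_1\}$, $\Phi_\zeta=T_\zeta-\mathrm{Id}$. $\Psi(x)=P_\Omega(\Pi x)-\Pi x$. $\{\Omega_1,\dots,\Omega_m\}$ is subtransversal at $\hat x$ for $\hat y\in\Psi(\hat x)$ relative to $\Lambda$ with constant $\kappa>0$ on $U$ if $\Psi$ is metrically subregular for $\hat y$ on $U$ relative to $\Lambda$ with constant $\kappa$, i.e.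 $\operatorname{dist}(x,\Psi^{-1}(\hat y)\cap\Lambda)\le\kappa\operatorname{dist}(\hat y,\Psi(x))$ for all $x\in U\cap\Lambda$. *)

theory Defs
  imports "HOL-Analysis.Analysis"
begin

text \<open>
  The product space \<open>E\<^sup>m\<close> is the type \<open>'a ^ 'n\<close> with \<open>'a\<close> a Euclidean space and \<open>m = CARD('n)\<close>;
  the library norm on it is the product Euclidean norm. The linear order on the finite index
  type \<open>'n\<close> plays the role of the order \<open>1 < 2 < \<dots> < m\<close>.
\<close>

definition idx_first :: "'n::{finite,linorder}" where
  "idx_first = Min UNIV"

definition idx_last :: "'n::{finite,linorder}" where
  "idx_last = Max UNIV"

text \<open>The index \<open>j + 1\<close>, meaningful for \<open>j \<noteq> idx_last\<close> only.\<close>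

definition idx_succ :: "'n \<Rightarrow> 'n::{finite,linorder}" where
  "idx_succ j = Min {j<..}"

text \<open>
  Distance to a set with the convention \<open>dist(x, \<emptyset>) = \<infinity>\<close>, which is why it is
  \<open>ereal\<close>-valued: the library's \<open>infdist\<close> is 0 for the empty set.
\<close>

definition dist_set :: "'a::metric_space \<Rightarrow> 'a set \<Rightarrow> ereal" where
  "dist_set x A = (INF y\<in>A. ereal (dist x y))"

lemma dist_set_empty: "dist_set x {} = \<infinity>"
  by (simp add: dist_set_def top_ereal_def)

lemma dist_set_eq_infdist:
  assumes "A \<noteq> {}"
  shows "dist_set x A = ereal (infdist x A)"
proof (rule antisym)
  show "ereal (infdist x A) \<le> dist_set x A"
    unfolding dist_set_def by (rule INF_greatest) (simp add: infdist_le)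
next
  show "dist_set x A \<le> ereal (infdist x A)"
  proof (rule ereal_le_epsilon2)
    fix e :: real
    assume "e > 0"
    then obtain y where y: "y \<in> A" "dist x y < infdist x A + e"
      using assms cINF_less_iff[of A "dist x" "infdist x A + e"] by (auto simp: infdist_def)
    have "dist_set x A \<le> ereal (dist x y)"
      unfolding dist_set_def using y(1) by (rule INF_lower)
    also have "\<dots> \<le> ereal (infdist x A) + ereal e"
      using y(2) by simp
    finally show "dist_set x A \<le> ereal (infdist x A) + ereal e" .
  qed
qed

text \<open>Set-valued maps are functions into sets; so are the projectors.\<close>

definition projector :: "'a::metric_space set \<Rightarrow> 'a \<Rightarrow> 'a set" where
  "projector C x = {y \<in> C. \<forall>z\<in>C. dist x y \<le> dist x z}"

definition Fix :: "('a \<Rightarrow> 'a set) \<Rightarrow> 'a set" where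
  "Fix T = {x. x \<in> T x}"

definition metrically_subregular ::
  "('a::metric_space \<Rightarrow> 'b::metric_space set) \<Rightarrow> 'b \<Rightarrow> 'a set \<Rightarrow> 'a set \<Rightarrow> real \<Rightarrow> bool" where
  "metrically_subregular F y U \<Lambda> \<kappa> \<longleftrightarrow>
    (\<forall>x\<in>U \<inter> \<Lambda>. dist_set x ({z. y \<in> F z} \<inter> \<Lambda>) \<le> ereal \<kappa> * dist_set y (F x))"

definition prod_set :: "('n::finite \<Rightarrow> 'a set) \<Rightarrow> ('a, 'n) vec set" where
  "prod_set A = {x. \<forall>j. x $ j \<in> A j}"

definition cyc_shift :: "('a, 'n) vec \<Rightarrow> ('a, 'n::{finite,linorder}) vec" where
  "cyc_shift x = (\<chi> j. if j = idx_last then x $ idx_first else x $ idx_succ j)"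

text \<open>
  \<open>P\<^sub>1 P\<^sub>2 \<dots> P\<^sub>m P\<^sub>1\<close>: in the fold over the index list \<open>1, 2, \<dots>, m, 1\<close> the rightmost projector is
  applied first.
\<close>

definition P0 :: "('n::{finite,linorder} \<Rightarrow> 'a::metric_space set) \<Rightarrow> 'a \<Rightarrow> 'a set" where
  "P0 \<Omega> u = foldr (\<lambda>j A. \<Union>y\<in>A. projector (\<Omega> j) y)
             (sorted_list_of_set UNIV @ [idx_first]) {u}"

definition W0 :: "('n::{finite,linorder} \<Rightarrow> 'a::metric_space set) \<Rightarrow> ('a, 'n) vec set" where
  "W0 \<Omega> = {x. x $ idx_last \<in> projector (\<Omega> idx_last) (x $ idx_first) \<and>
              (\<forall>j. j \<noteq> idx_last \<longrightarrow> x $ j \<in> projector (\<Omega> j) (x $ idx_succ j))}"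

definition Zset :: "('n::{finite,linorder} \<Rightarrow> 'a::euclidean_space set) \<Rightarrow> 'a \<Rightarrow> ('a, 'n) vec set" where
  "Zset \<Omega> u = {z - cyc_shift z | z. z \<in> W0 \<Omega> \<and> z $ idx_first = u}"

definition W :: "('a, 'n) vec \<Rightarrow> ('a::euclidean_space, 'n::{finite,linorder}) vec set" where
  "W \<zeta> = {x. x - cyc_shift x = \<zeta>}"

definition Tmap :: "('n::{finite,linorder} \<Rightarrow> 'a set) \<Rightarrow> ('a, 'n) vec \<Rightarrow> ('a, 'n) vec \<Rightarrow>
    ('a::euclidean_space, 'n) vec set" where
  "Tmap \<Omega> \<zeta> x = {\<chi> j. y - (\<Sum>i<j. \<zeta> $ i) | y. y \<in> P0 \<Omega> (x $ idx_first)}"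

definition Phi :: "('n::{finite,linorder} \<Rightarrow> 'a set) \<Rightarrow> ('a, 'n) vec \<Rightarrow> ('a, 'n) vec \<Rightarrow>
    ('a::euclidean_space, 'n) vec set" where
  "Phi \<Omega> \<zeta> x = {y - x | y. y \<in> Tmap \<Omega> \<zeta> x}"

definition Psi :: "('n::{finite,linorder} \<Rightarrow> 'a set) \<Rightarrow> ('a, 'n) vec \<Rightarrow>
    ('a::euclidean_space, 'n) vec set" where
  "Psi \<Omega> x = {y - cyc_shift x | y. y \<in> projector (prod_set \<Omega>) (cyc_shift x)}"

definition subtransversal :: "('n::{finite,linorder} \<Rightarrow> 'a set) \<Rightarrow> ('a, 'n) vec \<Rightarrow> ('a, 'n) vec \<Rightarrow>
    ('a::euclidean_space, 'n) vec set \<Rightarrow> real \<Rightarrow> ('a, 'n) vec set \<Rightarrow> bool" where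
  "subtransversal \<Omega> x y \<Lambda> \<kappa> U \<longleftrightarrow>
    y \<in> Psi \<Omega> x \<and> \<kappa> > 0 \<and> metrically_subregular (Psi \<Omega>) y U \<Lambda> \<kappa>"

text \<open>The set \<open>S = S\<^sub>1 \<times> \<dots> \<times> S\<^sub>m\<close> with \<open>S\<^sub>j = S\<^sub>0 - (\<zeta>\<^sub>1 + \<dots> + \<zeta>\<^bsub>j-1\<^esub>)\<close>.\<close>

definition Sprod :: "'a set \<Rightarrow> ('a, 'n) vec \<Rightarrow> ('a::euclidean_space, 'n::{finite,linorder}) vec set" where
  "Sprod S\<^sub>0 \<zeta> = prod_set (\<lambda>j. (\<lambda>u. u - (\<Sum>i<j. \<zeta> $ i)) ` S\<^sub>0)"

text \<open>
  R-linear convergence to 0 of a sequence of distances. The bound is asked for large \<open>k\<close> only;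
  for \<open>c > 0\<close> and finite terms this is the same as a bound for all \<open>k\<close>, whereas for \<open>c = 0\<close>
  (convergence in finitely many steps) a bound for all \<open>k\<close> would be too restrictive.
\<close>

definition R_linear_to_0 :: "(nat \<Rightarrow> ereal) \<Rightarrow> real \<Rightarrow> bool" where
  "R_linear_to_0 a c \<longleftrightarrow>
    a \<longlonglongrightarrow> 0 \<and> (\<exists>\<gamma>\<ge>0. \<forall>\<^sub>F k in sequentially. a k \<le> ereal (\<gamma> * c ^ k))"

end

theory Submission
  imports Defs
begin

text \<open>
  On \<open>W(\<zeta>)\<close> a point is determined by its first component, and distances there are \<open>sqrt m\<close> times those
  of the first components, so everything reduces to the iteration of \<open>P\<^sub>0\<close> on \<open>E\<close>. On \<open>\<Omega>\<^sub>1\<close> the innermost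
  projector of \<open>P\<^sub>0\<close> is the identity, whence \<open>P\<^sub>0\<close> is averaged there with constant \<open>m / (m + 1)\<close>. The
  iterates therefore converge to a fixed point and are eventually in \<open>U\<close>, where subtransversality
  and (c') bound the distance to \<open>S\<^sub>0\<close> by \<open>\<kappa>'\<close> times the step length; averagedness turns this
  bound into the contraction factor \<open>c\<close>.
\<close>

section \<open>Successors and induction on the finite index order\<close>

lemma idx_first_le: "idx_first \<le> (j :: 'n::{finite,linorder})"
  by (simp add: idx_first_def)

lemma idx_last_ge: "(j :: 'n::{finite,linorder}) \<le> idx_last"
  by (simp add: idx_last_def)

lemma greaterThan_nonempty:
  fixes j :: "'n::{finite,linorder}"
  assumes "j \<noteq> idx_last"
  shows "{j<..} \<noteq> {}"
  using assms idx_last_ge[of j] by (auto simp: less_le)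

lemma atLeast_idx_succ:
  fixes j :: "'n::{finite,linorder}"
  assumes "j \<noteq> idx_last"
  shows "{idx_succ j..} = {j<..}"
proof -
  have "idx_succ j \<in> {j<..}"
    unfolding idx_succ_def using greaterThan_nonempty[OF assms] by (intro Min_in) auto
  moreover have "idx_succ j \<le> i" if "j < i" for i
    unfolding idx_succ_def using that by (intro Min_le) auto
  ultimately show ?thesis by auto
qed

lemma lessThan_idx_succ:
  fixes j :: "'n::{finite,linorder}"
  assumes "j \<noteq> idx_last"
  shows "{..<idx_succ j} = insert j {..<j}"
proof -
  have "{..<idx_succ j} = - {idx_succ j..}" by auto
  also have "\<dots> = insert j {..<j}" unfolding atLeast_idx_succ[OF assms] by auto
  finally show ?thesis .
qed

text \<open>Passing from \<open>j\<close> to \<open>idx_succ j\<close> strictly shrinks the set of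
  indices from \<open>j\<close> upwards, so its cardinality serves as the measure.\<close>

lemma idx_down_induct [case_names last step]:
  fixes j :: "'n::{finite,linorder}"
  assumes "P idx_last" and "\<And>j. j \<noteq> idx_last \<Longrightarrow> P (idx_succ j) \<Longrightarrow> P j"
  shows "P j"
proof (induction "card {j..}" arbitrary: j rule: less_induct)
  case less
  show ?case
  proof (cases "j = idx_last")
    case False
    have "j \<in> {j..} - {j<..}" "{j<..} \<subseteq> {j..}" by auto
    then have "{j<..} \<subset> {j..}" by blast
    then have "card {idx_succ j..} < card {j..}"
      unfolding atLeast_idx_succ[OF False] by (rule psubset_card_mono[OF finite])
    then have "P (idx_succ j)" by (rule less)
    with False show ?thesis by (rule assms(2))
  qed (simp add: assms(1))
qed

text \<open>With the target \<open>j\<close> fixed, downward induction on \<open>i\<close> shows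
  that \<open>P\<close> travels from any \<open>i\<close> \<le> \<open>j\<close> up to
  \<open>j\<close>; then \<open>i\<close> is taken to be the first index.\<close>

lemma idx_up_induct [case_names first step]:
  fixes j :: "'n::{finite,linorder}"
  assumes "P idx_first" and "\<And>j. j \<noteq> idx_last \<Longrightarrow> P j \<Longrightarrow> P (idx_succ j)"
  shows "P j"
proof -
  have "i \<le> j \<longrightarrow> P i \<longrightarrow> P j" for i
  proof (induction i rule: idx_down_induct)
    case last
    then show ?case using idx_last_ge[of j] by auto
  next
    case (step i)
    show ?case
    proof (cases "i = j")
      case False
      show ?thesis
      proof (intro impI)
        assume "i \<le> j" "P i"
        then have "j \<in> {idx_succ i..}"
          unfolding atLeast_idx_succ[OF step(1)] using False by simp
        moreover have "P (idx_succ i)" using step(1) \<open>P i\<close> by (rule assms(2))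
        ultimately show "P j" using step by simp
      qed
    qed auto
  qed
  then show ?thesis using assms(1) idx_first_le[of j] by blast
qed

section \<open>The cyclic shift, projectors and the gap vector\<close>

lemma norm_vec_sq: "(norm (x :: ('a::real_normed_vector, 'n::finite) vec))\<^sup>2 = (\<Sum>j\<in>UNIV. (norm (x $ j))\<^sup>2)"
  by (simp add: norm_vec_def L2_set_def sum_nonneg)

text \<open>The shift reindexes the coordinates along \<open>s\<close>, which is onto and hence a
  permutation of the finite index type; the sum of squared norms is therefore preserved.\<close>

lemma norm_cyc_shift:
  fixes x :: "('a::real_normed_vector, 'n::{finite,linorder}) vec"
  shows "norm (cyc_shift x) = norm x"
proof -
  define s :: "'n \<Rightarrow> 'n" where "s j = (if j = idx_last then idx_first else idx_succ j)" for j
  have "j \<in> range s" for j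
  proof (induction j rule: idx_up_induct)
    case first
    show ?case by (rule range_eqI[of _ _ idx_last]) (simp add: s_def)
  next
    case (step j)
    then show ?case by (intro range_eqI[of _ _ j]) (simp add: s_def)
  qed
  then have "surj s" by auto
  then have "bij s" using finite_UNIV_surj_inj[of s] by (simp add: bij_def)
  then have "(\<Sum>j\<in>UNIV. (norm (x $ s j))\<^sup>2) = (\<Sum>j\<in>UNIV. (norm (x $ j))\<^sup>2)"
    by (rule sum.reindex_bij_betw)
  moreover have "cyc_shift x = (\<chi> j. x $ s j)"
    by (simp add: cyc_shift_def s_def vec_eq_iff)
  ultimately have "(norm (cyc_shift x))\<^sup>2 = (norm x)\<^sup>2"
    by (simp add: norm_vec_sq)
  then show ?thesis by simp
qed

lemma projector_eq_closest_point:
  fixes C :: "'a::euclidean_space set"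
  assumes "closed C" "convex C" "C \<noteq> {}"
  shows "projector C x = {closest_point C x}"
proof -
  have "y = closest_point C x" if "y \<in> projector C x" for y
    using that assms by (intro closest_point_unique) (auto simp: projector_def)
  moreover have "closest_point C x \<in> projector C x"
    using closest_point_exists[OF assms(1,3), of x] by (auto simp: projector_def)
  ultimately show ?thesis by blast
qed

text \<open>Each projection makes an obtuse angle with the other one; adding these two variational
  inequalities and expanding the squares gives the estimate.\<close>

lemma closest_point_firm:
  fixes C :: "'a::euclidean_space set"
  assumes "closed C" "convex C" "C \<noteq> {}"
  shows "(norm (closest_point C x - closest_point C y))\<^sup>2
       + (norm ((x - closest_point C x) - (y - closest_point C y)))\<^sup>2 \<le> (norm (x - y))\<^sup>2"
proof -
  let ?p = "closest_point C x" and ?q = "closest_point C y"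
  have "?p \<in> C" "?q \<in> C" using assms closest_point_in_set by blast+
  then have "(x - ?p) \<bullet> (?q - ?p) \<le> 0" "(y - ?q) \<bullet> (?p - ?q) \<le> 0"
    using assms by (auto intro: closest_point_dot)
  then show ?thesis
    unfolding power2_norm_eq_inner by (simp add: inner_simps inner_commute)
qed

text \<open>Replacing only the \<open>j\<close>-th coordinate of \<open>y\<close> by a competitor
  stays in the product and leaves every other term of the squared distance unchanged, so minimality
  passes to the coordinate.\<close>

lemma projector_prod_set_component:
  assumes "y \<in> projector (prod_set \<Omega>) v"
  shows "y $ j \<in> projector (\<Omega> j) (v $ j)"
proof -
  have y: "y $ i \<in> \<Omega> i" for i using assms by (simp add: projector_def prod_set_def)
  have "dist (v $ j) (y $ j) \<le> dist (v $ j) w" if w: "w \<in> \<Omega> j" for w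
  proof -
    define z where "z = (\<chi> i. if i = j then w else y $ i)"
    have "z \<in> prod_set \<Omega>" using y w by (simp add: z_def prod_set_def)
    then have "dist v y \<le> dist v z" using assms by (simp add: projector_def)
    then have "(\<Sum>i\<in>UNIV. (dist (v $ i) (y $ i))\<^sup>2) \<le> (\<Sum>i\<in>UNIV. (dist (v $ i) (z $ i))\<^sup>2)"
      by (simp add: dist_vec_def L2_set_def)
    moreover have "(\<Sum>i\<in>UNIV - {j}. (dist (v $ i) (y $ i))\<^sup>2) = (\<Sum>i\<in>UNIV - {j}. (dist (v $ i) (z $ i))\<^sup>2)"
      by (intro sum.cong) (auto simp: z_def)
    ultimately have "(dist (v $ j) (y $ j))\<^sup>2 \<le> (dist (v $ j) (z $ j))\<^sup>2"
      by (simp add: sum.remove[of UNIV j])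
    then have "(dist (v $ j) (y $ j))\<^sup>2 \<le> (dist (v $ j) w)\<^sup>2" by (simp add: z_def)
    then show ?thesis by (rule power2_le_imp_le) simp
  qed
  with y show ?thesis by (simp add: projector_def)
qed

text \<open>Firm nonexpansiveness of the projector of the product set, combined with the shift being an isometry.\<close>

lemma W0_gap_unique:
  fixes \<Omega> :: "'n::{finite,linorder} \<Rightarrow> 'a::euclidean_space set"
  assumes \<Omega>: "\<And>j. \<Omega> j \<noteq> {}" "\<And>j. closed (\<Omega> j)" "\<And>j. convex (\<Omega> j)"
    and "z \<in> W0 \<Omega>" "w \<in> W0 \<Omega>"
  shows "z - cyc_shift z = w - cyc_shift w"
proof -
  have cp: "x $ j = closest_point (\<Omega> j) (cyc_shift x $ j)" if "x \<in> W0 \<Omega>" for x j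
    using that \<Omega> projector_eq_closest_point[of "\<Omega> j"] by (auto simp: W0_def cyc_shift_def)
  have shift: "cyc_shift z - cyc_shift w = cyc_shift (z - w)"
    by (simp add: cyc_shift_def vec_eq_iff)
  have "(norm (z $ j - w $ j))\<^sup>2 + (norm ((cyc_shift z $ j - z $ j) - (cyc_shift w $ j - w $ j)))\<^sup>2
      \<le> (norm (cyc_shift z $ j - cyc_shift w $ j))\<^sup>2" for j
    using closest_point_firm[of "\<Omega> j" "cyc_shift z $ j" "cyc_shift w $ j"] \<Omega> cp assms(4,5) by metis
  then have "(norm (z - w))\<^sup>2 + (norm ((cyc_shift z - z) - (cyc_shift w - w)))\<^sup>2
      \<le> (norm (cyc_shift z - cyc_shift w))\<^sup>2"
    unfolding norm_vec_sq by (simp flip: sum.distrib add: sum_mono)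
  then have "(cyc_shift z - z) - (cyc_shift w - w) = 0"
    unfolding shift norm_cyc_shift by simp
  then show ?thesis by (simp add: algebra_simps)
qed

section \<open>Compositions of projectors and their averagedness\<close>

definition proj_comp :: "('i \<Rightarrow> 'a::euclidean_space set) \<Rightarrow> 'i list \<Rightarrow> 'a \<Rightarrow> 'a" where
  "proj_comp \<Omega> js x = foldr (\<lambda>j. closest_point (\<Omega> j)) js x"

lemma proj_comp_simps [simp]:
  "proj_comp \<Omega> [] x = x"
  "proj_comp \<Omega> (j # js) x = closest_point (\<Omega> j) (proj_comp \<Omega> js x)"
  "proj_comp \<Omega> (js @ ks) x = proj_comp \<Omega> js (proj_comp \<Omega> ks x)"
  by (simp_all add: proj_comp_def)

lemma P0_eq_proj_comp:
  fixes \<Omega> :: "'n::{finite,linorder} \<Rightarrow> 'a::euclidean_space set"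
  assumes "\<And>j. \<Omega> j \<noteq> {}" "\<And>j. closed (\<Omega> j)" "\<And>j. convex (\<Omega> j)"
  shows "P0 \<Omega> u = {proj_comp \<Omega> (sorted_list_of_set UNIV @ [idx_first]) u}"
proof -
  have "foldr (\<lambda>j A. \<Union>y\<in>A. projector (\<Omega> j) y) js {u} = {proj_comp \<Omega> js u}" for js
    by (induction js) (simp_all add: projector_eq_closest_point assms)
  then show ?thesis unfolding P0_def .
qed

lemma continuous_on_proj_comp:
  fixes \<Omega> :: "'i \<Rightarrow> 'a::euclidean_space set"
  assumes "\<And>j. \<Omega> j \<noteq> {}" "\<And>j. closed (\<Omega> j)" "\<And>j. convex (\<Omega> j)"
  shows "continuous_on UNIV (proj_comp \<Omega> js)"
proof (induction js)
  case Nil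
  then show ?case by (simp add: continuous_on_id)
next
  case (Cons j js)
  have "continuous_on UNIV (closest_point (\<Omega> j))"
    using assms by (intro continuous_on_closest_point)
  with Cons show ?case by (auto intro: continuous_on_compose2)
qed

text \<open>With the averaging constant \<open>\<alpha> = n / (n + 1)\<close> of \<open>n\<close> firmly nonexpansive maps, the factor \<open>n\<close> is \<open>\<alpha> / (1 - \<alpha>)\<close>.\<close>

lemma proj_comp_averaged:
  fixes \<Omega> :: "'i \<Rightarrow> 'a::euclidean_space set"
  assumes "\<And>j. \<Omega> j \<noteq> {}" "\<And>j. closed (\<Omega> j)" "\<And>j. convex (\<Omega> j)"
  shows "norm (proj_comp \<Omega> js x - proj_comp \<Omega> js y) \<le> norm (x - y) \<and>
    (norm ((x - proj_comp \<Omega> js x) - (y - proj_comp \<Omega> js y)))\<^sup>2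
      \<le> real (length js) * ((norm (x - y))\<^sup>2 - (norm (proj_comp \<Omega> js x - proj_comp \<Omega> js y))\<^sup>2)"
proof (induction js)
  case (Cons j js)
  let ?a = "proj_comp \<Omega> js x" and ?b = "proj_comp \<Omega> js y"
  let ?c = "closest_point (\<Omega> j) ?a" and ?d = "closest_point (\<Omega> j) ?b"
  define n where "n = real (length js)"
  \<comment> \<open>\<open>p\<close> collects the displacement difference of the projectors already
    applied and \<open>q\<close> that of the new one; \<open>A\<close> and \<open>B\<close> are the
    matching losses in squared distance.\<close>
  define p where "p = (x - ?a) - (y - ?b)"
  define q where "q = (?a - ?c) - (?b - ?d)"
  define A where "A = (norm (x - y))\<^sup>2 - (norm (?a - ?b))\<^sup>2"
  define B where "B = (norm (?a - ?b))\<^sup>2 - (norm (?c - ?d))\<^sup>2"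
  have "n \<ge> 0" by (simp add: n_def)
  have A: "A \<ge> 0" and p: "(norm p)\<^sup>2 \<le> n * A"
    using Cons by (auto simp: A_def p_def n_def intro: power_mono)
  have q: "(norm q)\<^sup>2 \<le> B"
    using closest_point_firm[of "\<Omega> j" ?a ?b] assms by (simp add: B_def q_def)
  then have B: "B \<ge> 0" by (meson order_trans zero_le_power2)
  have "(norm (p + q))\<^sup>2 \<le> (norm p + norm q)\<^sup>2"
    by (intro power_mono norm_triangle_ineq) simp
  \<comment> \<open>The cross term is at most 2 sqrt(A n B), and the arithmetic-geometric mean
    inequality is applied to \<open>A\<close> and \<open>n * B\<close>. This weighting makes the
    total exactly \<open>(n + 1) * (A + B)\<close>.\<close>
  moreover have "2 * (norm p * norm q) \<le> A + n * B"
  proof -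
    have "(norm p * norm q)\<^sup>2 \<le> (n * A) * B"
      unfolding power_mult_distrib using p q A B \<open>n \<ge> 0\<close> by (intro mult_mono) auto
    then have "(2 * (norm p * norm q))\<^sup>2 \<le> 4 * (A * (n * B))"
      by (simp add: power_mult_distrib algebra_simps)
    also have "\<dots> \<le> (A + n * B)\<^sup>2"
      using zero_le_power2[of "A - n * B"] by (simp add: power2_eq_square algebra_simps)
    finally show ?thesis using A B \<open>n \<ge> 0\<close> by (auto intro: power2_le_imp_le)
  qed
  ultimately have "(norm (p + q))\<^sup>2 \<le> (n + 1) * (A + B)"
    using p q by (simp add: power2_sum algebra_simps)
  moreover have "p + q = (x - ?c) - (y - ?d)" by (simp add: p_def q_def)
  moreover have "A + B = (norm (x - y))\<^sup>2 - (norm (?c - ?d))\<^sup>2" by (simp add: A_def B_def)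
  moreover have "norm (?c - ?d) \<le> norm (x - y)"
    using \<open>A \<ge> 0\<close> \<open>B \<ge> 0\<close> by (auto simp: A_def B_def intro: power2_le_imp_le)
  ultimately show ?case by (simp add: n_def add.commute)
qed simp

section \<open>Projection cycles and the fixed points of \<open>P0\<close>\<close>

lemma sorted_list_of_set_atLeast:
  "sorted_list_of_set {j..} = j # sorted_list_of_set {(j::'n::{finite,linorder})<..}"
proof -
  have "{j..} = insert j {j<..}" by auto
  moreover have "Min (insert j {j<..}) = j" by (intro Min_eqI) auto
  ultimately show ?thesis
    using sorted_list_of_set_nonempty[of "{j..}"] by (simp add: insert_Diff_if)
qed

lemma sorted_list_of_set_UNIV:
  "sorted_list_of_set (UNIV :: 'n::{finite,linorder} set) = sorted_list_of_set {idx_first..}"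
  using idx_first_le by (metis UNIV_eq_I atLeast_iff)

lemma idx_last_greaterThan: "{idx_last :: 'n::{finite,linorder}<..} = {}"
  by (metis idx_last_ge greaterThan_iff ex_in_conv leD)

text \<open>Unrolling the cycle conditions downwards from the last index expresses every component
  through the first one.\<close>

lemma proj_comp_W0:
  fixes \<Omega> :: "'n::{finite,linorder} \<Rightarrow> 'a::euclidean_space set"
  assumes "\<And>j. \<Omega> j \<noteq> {}" "\<And>j. closed (\<Omega> j)" "\<And>j. convex (\<Omega> j)"
    and "z \<in> W0 \<Omega>"
  shows "z $ j = proj_comp \<Omega> (sorted_list_of_set {j..}) (z $ idx_first)"
proof (induction j rule: idx_down_induct)
  case last
  then show ?case using assms
    by (simp add: W0_def sorted_list_of_set_atLeast idx_last_greaterThan projector_eq_closest_point)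
next
  case (step j)
  then show ?case using assms
    by (simp add: W0_def sorted_list_of_set_atLeast[of j] projector_eq_closest_point
        flip: atLeast_idx_succ)
qed

text \<open>The fixed point equation says that projecting \<open>u\<close> successively onto the
  last set, then down to the first, returns to \<open>u\<close>. The intermediate points form the
  required cycle; conversely, a cycle read at its first index gives this equation.\<close>

lemma Fix_P0_eq_W0:
  fixes \<Omega> :: "'n::{finite,linorder} \<Rightarrow> 'a::euclidean_space set"
  assumes \<Omega>: "\<And>j. \<Omega> j \<noteq> {}" "\<And>j. closed (\<Omega> j)" "\<And>j. convex (\<Omega> j)"
  shows "Fix (P0 \<Omega>) = {z $ idx_first |z. z \<in> W0 \<Omega>}"
proof (rule set_eqI)
  fix u
  let ?Q = "\<lambda>j. proj_comp \<Omega> (sorted_list_of_set {j..})"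
  have in\<Omega>: "?Q idx_first v \<in> \<Omega> idx_first" for v
    using \<Omega> by (simp add: sorted_list_of_set_atLeast closest_point_in_set)
  have fix_iff: "u \<in> Fix (P0 \<Omega>) \<longleftrightarrow> u = ?Q idx_first u"
  proof -
    have "u \<in> Fix (P0 \<Omega>) \<longleftrightarrow> u = ?Q idx_first (closest_point (\<Omega> idx_first) u)"
      using \<Omega> by (simp add: Fix_def P0_eq_proj_comp sorted_list_of_set_UNIV)
    also have "\<dots> \<longleftrightarrow> u = ?Q idx_first u"
      \<comment> \<open>Either equation puts \<open>u\<close> in the range of the outermost
        projector, hence in the first set, where the innermost projector is the identity.\<close>
      using in\<Omega>[of "closest_point (\<Omega> idx_first) u"] in\<Omega>[of u] closest_point_self[of u "\<Omega> idx_first"] by auto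
    finally show ?thesis .
  qed
  show "u \<in> Fix (P0 \<Omega>) \<longleftrightarrow> u \<in> {z $ idx_first |z. z \<in> W0 \<Omega>}"
  proof
    assume "u \<in> Fix (P0 \<Omega>)"
    then have u: "?Q idx_first u = u" using fix_iff by simp
    have last: "?Q idx_last u = closest_point (\<Omega> idx_last) u"
      by (simp add: sorted_list_of_set_atLeast idx_last_greaterThan)
    have step: "?Q j u = closest_point (\<Omega> j) (?Q (idx_succ j) u)" if "j \<noteq> idx_last" for j
      by (simp add: sorted_list_of_set_atLeast[of j] atLeast_idx_succ[OF that])
    have "(\<chi> j. ?Q j u) \<in> W0 \<Omega>"
      unfolding W0_def using \<Omega> last step by (simp add: u projector_eq_closest_point)
    with u show "u \<in> {z $ idx_first |z. z \<in> W0 \<Omega>}"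
      by (intro CollectI exI[of _ "\<chi> j. ?Q j u"]) simp
  next
    assume "u \<in> {z $ idx_first |z. z \<in> W0 \<Omega>}"
    then obtain z where "z \<in> W0 \<Omega>" "u = z $ idx_first" by blast
    then show "u \<in> Fix (P0 \<Omega>)"
      unfolding fix_iff using proj_comp_W0[of \<Omega>, OF \<Omega>] by blast
  qed
qed

section \<open>Parametrizing \<open>W \<zeta>\<close> by the first component\<close>

definition W_embed :: "('a::ab_group_add, 'n::{finite,linorder}) vec \<Rightarrow> 'a \<Rightarrow> ('a, 'n) vec" where
  "W_embed \<zeta> a = (\<chi> j. a - (\<Sum>i<j. \<zeta> $ i))"

lemma W_embed_first [simp]: "W_embed \<zeta> a $ idx_first = a"
proof -
  have "{..<idx_first :: 'b} = {}" by (metis idx_first_le lessThan_iff ex_in_conv leD)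
  then show ?thesis by (simp add: W_embed_def)
qed

text \<open>The defining equation at \<open>j\<close> reads
  \<open>x $ idx_succ j = x $ j - \<zeta> $ j\<close>, which telescopes from the first index. So
  \<open>W_embed\<close> is the only candidate with a given first component.\<close>

lemma W_imp_W_embed:
  assumes "x \<in> W \<zeta>"
  shows "x = W_embed \<zeta> (x $ idx_first)"
proof -
  have "x $ j = W_embed \<zeta> (x $ idx_first) $ j" for j
  proof (induction j rule: idx_up_induct)
    case first
    then show ?case by simp
  next
    case (step j)
    have "x $ j - cyc_shift x $ j = \<zeta> $ j" using assms by (auto simp: W_def)
    then have "x $ idx_succ j = x $ j - \<zeta> $ j" using step(1) by (simp add: cyc_shift_def algebra_simps)
    with step show ?case by (simp add: W_embed_def lessThan_idx_succ diff_diff_eq add.commute)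
  qed
  then show ?thesis unfolding vec_eq_iff by blast
qed

text \<open>Solvability of \<open>x - \<Pi> x = \<zeta>\<close> replaces the condition that the components of \<open>\<zeta>\<close> sum to \<open>0\<close>.\<close>

lemma W_embed_in_W:
  assumes "z \<in> W \<zeta>"
  shows "W_embed \<zeta> a \<in> W \<zeta>"
proof -
  \<comment> \<open>The new point is \<open>z\<close> with the same vector added to every component,
    and such a translation does not change the difference between a point and its shift.\<close>
  have "W_embed \<zeta> a $ j = z $ j + (a - z $ idx_first)" for j
  proof -
    have "z $ j = W_embed \<zeta> (z $ idx_first) $ j"
      by (rule arg_cong[of _ _ "\<lambda>v. v $ j", OF W_imp_W_embed[OF assms]])
    then show ?thesis by (simp add: W_embed_def)
  qed
  then have "W_embed \<zeta> a - cyc_shift (W_embed \<zeta> a) = z - cyc_shift z"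
    by (simp add: vec_eq_iff cyc_shift_def)
  with assms show ?thesis by (simp add: W_def)
qed

lemma dist_W_embed:
  fixes \<zeta> :: "('a::euclidean_space, 'n::{finite,linorder}) vec"
  shows "dist (W_embed \<zeta> a) (W_embed \<zeta> b) = sqrt (real CARD('n)) * dist a b"
proof -
  have "dist (W_embed \<zeta> a $ j) (W_embed \<zeta> b $ j) = dist a b" for j
    by (simp add: W_embed_def dist_norm)
  then show ?thesis by (simp add: dist_vec_def L2_set_constant)
qed

lemma Tmap_eq_W_embed: "Tmap \<Omega> \<zeta> x = W_embed \<zeta> ` P0 \<Omega> (x $ idx_first)"
  by (auto simp: Tmap_def W_embed_def)

lemma Fix_Tmap: "Fix (Tmap \<Omega> \<zeta>) = W_embed \<zeta> ` Fix (P0 \<Omega>)"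
  by (auto simp: Fix_def Tmap_eq_W_embed)

section \<open>Distances to sets in the product space\<close>

lemma dist_set_attained:
  assumes "p \<in> A" "\<And>y. y \<in> A \<Longrightarrow> dist x p \<le> dist x y"
  shows "dist_set x A = ereal (dist x p)"
  unfolding dist_set_def using assms by (intro antisym INF_lower INF_greatest) auto

lemma dist_set_antimono: "A \<subseteq> B \<Longrightarrow> dist_set x B \<le> dist_set x A"
  unfolding dist_set_def by (rule INF_superset_mono) auto

text \<open>The product set allows a different point of \<open>A\<close> in each component, yet the
  distance is the same: every component is at least \<open>dist a p\<close> away, and the embedded
  nearest point \<open>p\<close> attains this bound in all components at once.\<close>

lemma dist_set_W_embed:
  fixes \<zeta> :: "('a::euclidean_space, 'n::{finite,linorder}) vec"
  assumes "closed A" "A \<noteq> {}"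
  shows "dist_set (W_embed \<zeta> a) (W_embed \<zeta> ` A) = ereal (sqrt (real CARD('n)) * infdist a A)"
    and "dist_set (W_embed \<zeta> a) (Sprod A \<zeta>) = ereal (sqrt (real CARD('n)) * infdist a A)"
proof -
  obtain p where p: "p \<in> A" "infdist a A = dist a p"
    using infdist_attains_inf[OF assms] by metis
  have min: "dist a p \<le> dist a y" if "y \<in> A" for y
    using infdist_le[OF that, of a] p by simp
  show "dist_set (W_embed \<zeta> a) (W_embed \<zeta> ` A) = ereal (sqrt (real CARD('n)) * infdist a A)"
    using p min by (subst dist_set_attained[of "W_embed \<zeta> p"])
      (auto simp: dist_W_embed intro: mult_left_mono)
  have "dist (W_embed \<zeta> a) (W_embed \<zeta> p) \<le> dist (W_embed \<zeta> a) y" if "y \<in> Sprod A \<zeta>" for y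
  proof -
    have "dist a p \<le> dist (W_embed \<zeta> a $ j) (y $ j)" for j
    proof -
      have "y $ j \<in> (\<lambda>u. u - (\<Sum>i<j. \<zeta> $ i)) ` A"
        using that by (simp add: Sprod_def prod_set_def)
      then obtain s where "s \<in> A" "y $ j = s - (\<Sum>i<j. \<zeta> $ i)" by blast
      then show ?thesis using min[of s] by (simp add: W_embed_def dist_norm)
    qed
    then have "L2_set (\<lambda>j::'n. dist a p) UNIV \<le> dist (W_embed \<zeta> a) y"
      unfolding dist_vec_def by (intro L2_set_mono) auto
    then show ?thesis by (simp add: dist_W_embed L2_set_constant)
  qed
  moreover have "W_embed \<zeta> p \<in> Sprod A \<zeta>"
    using p by (auto simp: Sprod_def prod_set_def W_embed_def)
  ultimately show "dist_set (W_embed \<zeta> a) (Sprod A \<zeta>) = ereal (sqrt (real CARD('n)) * infdist a A)"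
    by (subst dist_set_attained) (auto simp: dist_W_embed p)
qed

section \<open>Convergence of Fejer monotone iterations and R-linear rates\<close>

text \<open>Distances to each fixed point decrease, so the iterates are bounded and have a cluster
  point. Vanishing steps and continuity make it a fixed point; its distances to the whole sequence
  converge, and along the subsequence they tend to 0.\<close>

lemma fejer_iteration_converges:
  fixes T :: "'a::euclidean_space \<Rightarrow> 'a" and y :: "nat \<Rightarrow> 'a"
  assumes cont: "continuous_on UNIV T"
    and y: "\<And>k. y (Suc k) = T (y k)"
    and fejer: "\<And>k u. T u = u \<Longrightarrow> (norm (y k - y (Suc k)))\<^sup>2
        \<le> M * ((norm (y k - u))\<^sup>2 - (norm (y (Suc k) - u))\<^sup>2)"
    and "M > 0" and "T u = u"
  obtains l where "T l = l" "y \<longlonglongrightarrow> l"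
proof -
  have dec: "decseq (\<lambda>k. norm (y k - v))" if "T v = v" for v
  proof (rule decseq_SucI)
    fix k
    have "0 \<le> M * ((norm (y k - v))\<^sup>2 - (norm (y (Suc k) - v))\<^sup>2)"
      using fejer[OF that, of k] by (meson order_trans zero_le_power2)
    with \<open>M > 0\<close> have "(norm (y (Suc k) - v))\<^sup>2 \<le> (norm (y k - v))\<^sup>2"
      by (simp add: zero_le_mult_iff)
    then show "norm (y (Suc k) - v) \<le> norm (y k - v)"
      by (rule power2_le_imp_le) simp
  qed
  have conv: "\<exists>L. (\<lambda>k. norm (y k - v)) \<longlonglongrightarrow> L" if "T v = v" for v
    using decseq_convergent[OF dec[OF that], of 0] by (metis norm_ge_zero)
  obtain L where L: "(\<lambda>k. norm (y k - u)) \<longlonglongrightarrow> L" using conv \<open>T u = u\<close> by blast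
  \<comment> \<open>Consecutive squared distances to \<open>u\<close> have the same limit, so the
    bound on the squared step length tends to 0.\<close>
  have lim: "(\<lambda>k. M * ((norm (y k - u))\<^sup>2 - (norm (y (Suc k) - u))\<^sup>2)) \<longlonglongrightarrow> M * (L\<^sup>2 - L\<^sup>2)"
    using L LIMSEQ_Suc[OF L] by (intro tendsto_intros)
  have "(\<lambda>k. (norm (y k - y (Suc k)))\<^sup>2) \<longlonglongrightarrow> 0"
    by (rule real_tendsto_sandwich[OF _ _ tendsto_const lim[simplified]]) (use fejer \<open>T u = u\<close> in auto)
  from tendsto_real_sqrt[OF this] have "(\<lambda>k. norm (y k - y (Suc k))) \<longlonglongrightarrow> 0" by simp
  then have diff: "(\<lambda>k. y k - T (y k)) \<longlonglongrightarrow> 0" by (simp add: tendsto_norm_zero_iff y)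
  have "y k \<in> cball u (norm (y 0 - u))" for k
    using decseqD[OF dec[OF \<open>T u = u\<close>], of 0 k] by (simp add: dist_norm norm_minus_commute)
  then obtain l r where r: "strict_mono (r :: nat \<Rightarrow> nat)" "(y \<circ> r) \<longlonglongrightarrow> l"
    using compact_cball[of u "norm (y 0 - u)"] unfolding compact_def by meson
  have "(\<lambda>k. T ((y \<circ> r) k)) \<longlonglongrightarrow> T l"
    by (rule continuous_on_tendsto_compose[OF cont r(2)]) auto
  then have "(\<lambda>k. (y \<circ> r) k - T ((y \<circ> r) k)) \<longlonglongrightarrow> l - T l"
    using r(2) by (intro tendsto_diff)
  moreover have "(\<lambda>k. (y \<circ> r) k - T ((y \<circ> r) k)) \<longlonglongrightarrow> 0"
    using LIMSEQ_subseq_LIMSEQ[OF diff r(1)] by (simp add: o_def)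
  ultimately have "l - T l = 0" by (rule LIMSEQ_unique)
  then have l: "T l = l" by simp
  obtain K where K: "(\<lambda>k. norm (y k - l)) \<longlonglongrightarrow> K" using conv l by blast
  have "(\<lambda>k. norm ((y \<circ> r) k - l)) \<longlonglongrightarrow> norm (l - l)"
    using r(2) by (intro tendsto_intros)
  moreover have "(\<lambda>k. norm ((y \<circ> r) k - l)) \<longlonglongrightarrow> K"
    using LIMSEQ_subseq_LIMSEQ[OF K r(1)] by (simp add: o_def)
  ultimately have "K = 0" using LIMSEQ_unique by fastforce
  then have "y \<longlonglongrightarrow> l" using K by (simp add: tendsto_norm_zero_iff LIM_zero_iff)
  with l that show thesis by blast
qed

lemma R_linear_to_0I:
  fixes a :: "nat \<Rightarrow> real"
  assumes "\<And>k. a k \<ge> 0" and "c < 1" and step: "\<forall>\<^sub>F k in sequentially. a (Suc k) \<le> c * a k"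
  shows "R_linear_to_0 (\<lambda>k. ereal (a k)) c"
proof -
  obtain N where N: "\<And>k. k \<ge> N \<Longrightarrow> a (Suc k) \<le> c * a k"
    using step unfolding eventually_sequentially by blast
  have "a \<longlonglongrightarrow> 0 \<and> (\<exists>\<gamma>\<ge>0. \<forall>\<^sub>F k in sequentially. a k \<le> \<gamma> * c ^ k)"
  proof (cases "c > 0")
    case True
    have bound: "a k \<le> a N / c ^ N * c ^ k" if "k \<ge> N" for k
      using that
    proof (induction k rule: dec_induct)
      case base
      then show ?case using True by simp
    next
      case (step k)
      have "a (Suc k) \<le> c * a k" using N step by simp
      also have "\<dots> \<le> c * (a N / c ^ N * c ^ k)" using step True by (intro mult_left_mono) auto
      finally show ?case by (simp add: mult_ac)
    qed
    have "(\<lambda>k. c ^ k) \<longlonglongrightarrow> 0"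
      using True \<open>c < 1\<close> by (intro LIMSEQ_power_zero) simp
    from real_tendsto_sandwich[OF _ _ tendsto_const tendsto_mult_right_zero[OF this]]
    have "a \<longlonglongrightarrow> 0"
      using bound assms(1) unfolding eventually_sequentially by blast
    moreover have "a N / c ^ N \<ge> 0" using True assms(1) by simp
    ultimately show ?thesis using bound unfolding eventually_sequentially by blast
  next
    case False
    \<comment> \<open>For \<open>c\<close> \<le> 0 the recursion bounds a nonnegative term by a
      nonpositive one, so all terms after index \<open>N\<close> vanish and \<open>\<gamma>\<close>
      = 0 serves, even where \<open>c ^ k\<close> is negative.\<close>
    have zero: "a k = 0" if k: "k \<ge> Suc N" for k
    proof -
      obtain i where i: "k = Suc i" "i \<ge> N" using k by (cases k) auto
      have "c * a i \<le> 0" using False assms(1)[of i] by (simp add: mult_nonpos_nonneg)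
      with N[OF i(2)] i assms(1)[of k] show ?thesis by simp
    qed
    then have ev: "\<forall>\<^sub>F k in sequentially. a k = 0" by (rule eventually_sequentiallyI)
    then have "a \<longlonglongrightarrow> 0" by (rule tendsto_eventually)
    moreover have "\<forall>\<^sub>F k in sequentially. a k \<le> 0 * c ^ k"
      using ev by (rule eventually_mono) simp
    ultimately show ?thesis by blast
  qed
  then show ?thesis
    unfolding R_linear_to_0_def zero_ereal_def by auto
qed

section \<open>From subtransversality to the linear rate\<close>

theorem corollary3p1:
  fixes \<Omega> :: "'n::{finite,linorder} \<Rightarrow> 'a::euclidean_space set"
    and \<zeta> :: "('a, 'n) vec" and u :: 'a
    and S\<^sub>0 :: "'a set" and S \<Lambda> U :: "('a, 'n) vec set"
    and \<kappa> \<sigma> \<kappa>' \<alpha> c :: real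
    and x :: "nat \<Rightarrow> ('a, 'n) vec"
  assumes "CARD('n) \<ge> 2"
    and "\<And>j. \<Omega> j \<noteq> {}" and "\<And>j. closed (\<Omega> j)" and "\<And>j. convex (\<Omega> j)"
    and "S\<^sub>0 = Fix (P0 \<Omega>)" and "S\<^sub>0 \<noteq> {}"
    and "u \<in> S\<^sub>0" and "\<zeta> \<in> Zset \<Omega> u"
    and "S = Sprod S\<^sub>0 \<zeta>" and "\<Lambda> = W \<zeta>"
    and "S \<subseteq> interior U"
    and "\<And>xh. xh \<in> S \<Longrightarrow> xh - cyc_shift xh = \<zeta> \<Longrightarrow> subtransversal \<Omega> xh \<zeta> \<Lambda> \<kappa> U"
    and "\<sigma> > 0"
    and "\<And>y. y \<in> \<Lambda> \<inter> U \<Longrightarrow> y $ idx_first \<in> \<Omega> idx_first \<Longrightarrow>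
           dist_set \<zeta> (Psi \<Omega> y) \<le> ereal \<sigma> * dist_set 0 (Phi \<Omega> \<zeta> y)"
    and "x 0 \<in> W \<zeta>" and "x 0 $ idx_first \<in> \<Omega> idx_first"
    and "\<And>k. x (Suc k) \<in> Tmap \<Omega> \<zeta> (x k)"
    and "\<kappa>' = \<kappa> * \<sigma>"
    and "\<alpha> = real CARD('n) / (real CARD('n) + 1)"
    and "c = sqrt (1 - (1 - \<alpha>) / (\<alpha> * \<kappa>'\<^sup>2))"
  shows "(\<forall>v\<in>S\<^sub>0. Zset \<Omega> v = {\<zeta>}) \<and>
         c < 1 \<and>
         (\<forall>\<^sub>F k in sequentially.
            dist_set (x (Suc k)) (Fix (Tmap \<Omega> \<zeta>) \<inter> S) \<le> ereal c * dist_set (x k) S) \<and>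
         R_linear_to_0 (\<lambda>k. dist_set (x k) (Fix (Tmap \<Omega> \<zeta>) \<inter> S)) c \<and>
         R_linear_to_0 (\<lambda>k. dist_set (x k $ idx_first) (Fix (P0 \<Omega>) \<inter> S\<^sub>0)) c"
proof -
  note \<Omega> = assms(2-4) and S0 = assms(5)
  define m where "m = real CARD('n)"
  have m: "m \<ge> 2" using assms(1) unfolding m_def by simp
  let ?L = "sorted_list_of_set (UNIV :: 'n set)"
  define Q where "Q = proj_comp \<Omega> (?L @ [idx_first])"
  have P0: "P0 \<Omega> v = {Q v}" for v unfolding Q_def using \<Omega> by (rule P0_eq_proj_comp)
  have S0_Q: "v \<in> S\<^sub>0 \<longleftrightarrow> Q v = v" for v unfolding S0 Fix_def by (auto simp: P0)
  have Q_in: "Q v \<in> \<Omega> idx_first" for v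
    using \<Omega> by (simp add: Q_def sorted_list_of_set_UNIV sorted_list_of_set_atLeast closest_point_in_set)
  have cont: "continuous_on UNIV Q" unfolding Q_def using \<Omega> by (rule continuous_on_proj_comp)
  have "S\<^sub>0 = {v. Q v = v}" using S0_Q by blast
  then have closed: "closed S\<^sub>0" by (simp add: closed_Collect_eq cont continuous_on_id)
  have averaged: "(norm (a - Q a))\<^sup>2 \<le> m * ((norm (a - v))\<^sup>2 - (norm (Q a - v))\<^sup>2)"
    if "a \<in> \<Omega> idx_first" "Q v = v" for a v
  proof -
    \<comment> \<open>Both points lie in the first set, so the innermost of the m + 1 projectors
      fixes them. Only m projectors remain, which gives the factor \<open>m\<close>.\<close>
    have "v \<in> \<Omega> idx_first" using Q_in[of v] that by simp
    then have "proj_comp \<Omega> ?L v = v" "proj_comp \<Omega> ?L a = Q a"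
      using that by (simp_all add: Q_def closest_point_self)
    then show ?thesis
      using proj_comp_averaged[of \<Omega> ?L a v] \<Omega> by (simp add: m_def)
  qed

  obtain z where z: "z \<in> W0 \<Omega>" "\<zeta> = z - cyc_shift z" "z $ idx_first = u"
    using assms(8) by (auto simp: Zset_def)
  then have zW: "z \<in> W \<zeta>" by (simp add: W_def)
  have gap: "w - cyc_shift w = \<zeta>" if "w \<in> W0 \<Omega>" for w
    using W0_gap_unique[of \<Omega>, OF \<Omega> that z(1)] z(2) by simp
  have Zset: "Zset \<Omega> v = {\<zeta>}" if "v \<in> S\<^sub>0" for v
    using that gap unfolding S0 Fix_P0_eq_W0[of \<Omega>, OF \<Omega>] by (auto simp: Zset_def)

  let ?e = "W_embed \<zeta>"
  \<comment> \<open>The cycle \<open>z\<close> lies in \<open>S\<close> and has gap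
    \<open>\<zeta>\<close>, so (b') can be applied at it; this yields \<open>\<kappa>\<close> > 0
    and the subregularity inequality on \<open>U \<inter> \<Lambda>\<close>.\<close>
  have "z = ?e u" using W_imp_W_embed[OF zW] z(3) by simp
  then have "z \<in> S" using assms(7) by (auto simp: assms(9) Sprod_def prod_set_def W_embed_def)
  then have "subtransversal \<Omega> z \<zeta> \<Lambda> \<kappa> U" using assms(12) z(2) by simp
  then have \<kappa>: "\<kappa> > 0" and subreg: "metrically_subregular (Psi \<Omega>) \<zeta> U \<Lambda> \<kappa>"
    by (auto simp: subtransversal_def)
  have \<kappa>': "\<kappa>' > 0" using \<kappa> assms(13,18) by simp
  define r where "r = 1 - 1 / (m * \<kappa>'\<^sup>2)"
  have "(1 - \<alpha>) / \<alpha> = 1 / m"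
    using m unfolding assms(19) m_def[symmetric] by (simp add: field_simps)
  then have "(1 - \<alpha>) / (\<alpha> * \<kappa>'\<^sup>2) = 1 / (m * \<kappa>'\<^sup>2)"
    by (simp flip: divide_divide_eq_left)
  then have c: "c = sqrt r" by (simp add: assms(20) r_def)
  \<comment> \<open>\<open>r\<close> may be negative; then \<open>c = - sqrt (- r) < 0\<close> and the distances vanish eventually.\<close>
  have "r < 1" using m \<kappa>' by (simp add: r_def)
  then have c1: "c < 1" by (simp add: c)

  have FixT: "Fix (Tmap \<Omega> \<zeta>) \<inter> S = ?e ` S\<^sub>0"
    by (auto simp: Fix_Tmap assms(9) S0 Sprod_def prod_set_def W_embed_def)
  have Psi_inv: "{w. \<zeta> \<in> Psi \<Omega> w} \<inter> \<Lambda> \<subseteq> ?e ` S\<^sub>0"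
  proof
    fix w assume "w \<in> {w. \<zeta> \<in> Psi \<Omega> w} \<inter> \<Lambda>"
    then have w: "\<zeta> \<in> Psi \<Omega> w" "w \<in> W \<zeta>" by (auto simp: assms(10))
    then have "w \<in> projector (prod_set \<Omega>) (cyc_shift w)"
      by (auto simp: Psi_def W_def)
    from projector_prod_set_component[OF this] have "w \<in> W0 \<Omega>"
      unfolding W0_def cyc_shift_def vec_lambda_beta by (intro CollectI conjI allI impI) metis+
    then have "w $ idx_first \<in> S\<^sub>0" unfolding S0 Fix_P0_eq_W0[of \<Omega>, OF \<Omega>] by blast
    with W_imp_W_embed[OF w(2)] show "w \<in> ?e ` S\<^sub>0" by blast
  qed

  define y where "y k = x k $ idx_first" for k
  have x_Suc: "x (Suc k) = ?e (Q (y k))" for k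
    using assms(17)[of k] by (simp add: Tmap_eq_W_embed P0 y_def)
  have y_Suc: "y (Suc k) = Q (y k)" for k by (simp add: y_def[of "Suc k"] x_Suc)
  have xW: "x k \<in> W \<zeta>" for k
    using assms(15) W_embed_in_W[OF zW] by (cases k) (auto simp: x_Suc)
  then have x: "x k = ?e (y k)" for k unfolding y_def by (rule W_imp_W_embed)
  have y_in: "y k \<in> \<Omega> idx_first" for k
    using assms(16) Q_in by (cases k) (auto simp: y_Suc, simp add: y_def)
  have averaged_y: "(norm (y k - y (Suc k)))\<^sup>2 \<le> m * ((norm (y k - v))\<^sup>2 - (norm (y (Suc k) - v))\<^sup>2)"
    if "Q v = v" for k v
    using averaged[OF y_in that] by (simp add: y_Suc)

  obtain l where l: "Q l = l" "y \<longlonglongrightarrow> l"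
    by (rule fejer_iteration_converges[where T = Q and y = y and M = m and u = u])
      (use cont y_Suc averaged_y m assms(7) S0_Q in auto)
  \<comment> \<open>A neighborhood of \<open>S\<close> need not contain a uniform tube around it, so
    distances tending to 0 would not suffice; convergence to a point of \<open>S\<close> puts the
    tail into the open set \<open>interior U\<close>.\<close>
  have "x \<longlonglongrightarrow> ?e l"
    unfolding x W_embed_def by (intro tendsto_intros l)
  moreover have "?e l \<in> S"
    using l S0_Q by (auto simp: assms(9) Sprod_def prod_set_def W_embed_def)
  ultimately have "\<forall>\<^sub>F k in sequentially. x k \<in> interior U"
    using assms(11) by (intro topological_tendstoD) auto
  then have ev_U: "\<forall>\<^sub>F k in sequentially. x k \<in> U"
    by (rule eventually_mono) (use interior_subset in auto)

  define d where "d k = infdist (y k) S\<^sub>0" for k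
  have d_nonneg: "d k \<ge> 0" for k by (simp add: d_def infdist_nonneg)
  note dist_e = dist_set_W_embed[OF closed assms(6), of \<zeta>, folded m_def]
  have contraction: "d (Suc k) \<le> c * d k" if "x k \<in> U" for k
  proof -
    have "ereal (sqrt m * d k) = dist_set (x k) (?e ` S\<^sub>0)" by (simp add: x d_def dist_e)
    also have "\<dots> \<le> dist_set (x k) ({w. \<zeta> \<in> Psi \<Omega> w} \<inter> \<Lambda>)"
      using Psi_inv by (rule dist_set_antimono)
    also have "\<dots> \<le> ereal \<kappa> * dist_set \<zeta> (Psi \<Omega> (x k))"
      using subreg that xW by (simp add: metrically_subregular_def assms(10))
    also have "\<dots> \<le> ereal \<kappa> * (ereal \<sigma> * dist_set 0 (Phi \<Omega> \<zeta> (x k)))"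
      using assms(10) assms(14)[of "x k"] that xW y_in \<kappa>
      by (intro ereal_mult_left_mono) (auto simp: y_def)
    \<comment> \<open>\<open>Phi\<close> is single-valued here, so its distance to 0 is the step
      length in the product space; the common factor \<open>sqrt m\<close> then cancels.\<close>
    also have "Phi \<Omega> \<zeta> (x k) = {?e (Q (y k)) - ?e (y k)}"
      by (auto simp: Phi_def Tmap_eq_W_embed P0 x)
    also have "dist_set 0 \<dots> = ereal (sqrt m * norm (y k - y (Suc k)))"
      using dist_W_embed[of \<zeta> "y k" "Q (y k)"]
      by (simp add: dist_set_def y_Suc m_def dist_norm norm_minus_commute)
    finally have "sqrt m * d k \<le> sqrt m * (\<kappa>' * norm (y k - y (Suc k)))"
      by (simp add: assms(18) mult_ac)
    then have "d k \<le> \<kappa>' * norm (y k - y (Suc k))" using m by simp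
    then have "(d k)\<^sup>2 \<le> (\<kappa>' * norm (y k - y (Suc k)))\<^sup>2"
      using d_nonneg by (intro power_mono) auto
    then have err: "(d k)\<^sup>2 / \<kappa>'\<^sup>2 \<le> (norm (y k - y (Suc k)))\<^sup>2"
      using \<kappa>' by (simp add: power_mult_distrib field_simps)
    \<comment> \<open>The nearest point \<open>p\<close> to \<open>y k\<close> in
      \<open>S\<^sub>0\<close> is a fixed point of \<open>Q\<close>, so averagedness applies to it,
      and its distance to \<open>y (Suc k)\<close> bounds \<open>d (Suc k)\<close>.\<close>
    obtain p where p: "p \<in> S\<^sub>0" "d k = dist (y k) p"
      using infdist_attains_inf[OF closed assms(6)] unfolding d_def by metis
    have "(d (Suc k))\<^sup>2 \<le> (norm (y (Suc k) - p))\<^sup>2"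
      using infdist_le[OF p(1), of "y (Suc k)"] d_nonneg[of "Suc k"]
      by (intro power_mono) (auto simp: d_def dist_norm)
    moreover have "(d k)\<^sup>2 / \<kappa>'\<^sup>2 \<le> m * ((d k)\<^sup>2 - (norm (y (Suc k) - p))\<^sup>2)"
      using averaged_y[of p k] err p S0_Q by (simp add: dist_norm)
    \<comment> \<open>Solving for the new squared distance leaves the factor 1 - 1 / (m
      \<kappa>'^2), which is \<open>r\<close>.\<close>
    then have "(norm (y (Suc k) - p))\<^sup>2 \<le> r * (d k)\<^sup>2"
      using m \<kappa>' by (simp add: r_def field_simps)
    \<comment> \<open>The function \<open>sqrt\<close> is monotone and multiplicative on all reals,
      so taking roots is valid also for negative \<open>r\<close>.\<close>
    ultimately have "sqrt ((d (Suc k))\<^sup>2) \<le> sqrt (r * (d k)\<^sup>2)"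
      by (intro real_sqrt_le_mono) linarith
    then show ?thesis using d_nonneg by (simp add: real_sqrt_mult c)
  qed
  have ev: "\<forall>\<^sub>F k in sequentially. d (Suc k) \<le> c * d k"
    using ev_U by (rule eventually_mono) (rule contraction)
  then have ev_m: "\<forall>\<^sub>F k in sequentially. sqrt m * d (Suc k) \<le> c * (sqrt m * d k)"
    by (rule eventually_mono) (use m in \<open>simp add: mult.left_commute\<close>)

  have dist_Fix: "dist_set (x k) (Fix (Tmap \<Omega> \<zeta>) \<inter> S) = ereal (sqrt m * d k)" for k
    by (simp add: FixT x d_def dist_e)
  have dist_S: "dist_set (x k) S = ereal (sqrt m * d k)" for k
    by (simp add: x d_def dist_e assms(9))
  have dist_S0: "dist_set (x k $ idx_first) (Fix (P0 \<Omega>) \<inter> S\<^sub>0) = ereal (d k)" for k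
    using dist_set_eq_infdist[OF assms(6)] by (simp add: S0[symmetric] d_def y_def)
  show ?thesis
    unfolding dist_Fix dist_S dist_S0
  proof (intro conjI ballI)
    show "\<forall>\<^sub>F k in sequentially. ereal (sqrt m * d (Suc k)) \<le> ereal c * ereal (sqrt m * d k)"
      using ev_m by simp
  qed (use Zset c1 ev ev_m d_nonneg m in \<open>auto intro!: R_linear_to_0I\<close>)
qed

end
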